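(* An ordered set $X$ is representable by ambiguous sets if and only if there exist a compact metric space $K$, a linear ordering on the set $K$, and a family of initial segments of $K$ with respect to this ordering such that each member of the family is an ambiguous subset of $K$ and the family, ordered by inclusion, is similar to $X$.
   Context: "Ordered set" means linearly ordered set. Two ordered sets are similar if there is an order preserving bijection between them. A subset of a metric space is ambiguous if it is both $F_\sigma$ and $G_\delta$. An ordered set is representable by ambiguous sets if it is similar to a family of ambiguous subsets of $\mathbb{R}$ that is linearly ordered by inclusion. An initial segment of an ordered set $K$ is a subset $H\subset K$ such that $a\in H$ and $b<a$ imply $b\in H$. *)

theory Defs
  imports "HOL-Analysis.Analysis"
begin

text \<open>
  An ordered set is a set \<open>X\<close> together with a reflexive relation \<open>r\<close> such that
  \<open>linear_order_on X r\<close>. Carriers may be empty.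
\<close>

definition inclusion_on :: "'a set set \<Rightarrow> 'a set rel"
  where "inclusion_on F = relation_of (\<subseteq>) F"

text \<open>
  Only one direction of monotonicity is required: between linear orders the inverse of an
  order-preserving bijection is again order preserving.
\<close>

definition similar :: "'a set \<Rightarrow> 'a rel \<Rightarrow> 'b set \<Rightarrow> 'b rel \<Rightarrow> bool"
  where "similar X r Y s \<longleftrightarrow>
    (\<exists>f. bij_betw f X Y \<and> monotone_on X (\<lambda>a b. (a, b) \<in> r) (\<lambda>a b. (a, b) \<in> s) f)"

definition ambiguous_in :: "'a topology \<Rightarrow> 'a set \<Rightarrow> bool"
  where "ambiguous_in T A \<longleftrightarrow> fsigma_in T A \<and> gdelta_in T A"

definition representable_by_ambiguous_sets :: "'a set \<Rightarrow> 'a rel \<Rightarrow> bool"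
  where "representable_by_ambiguous_sets X r \<longleftrightarrow>
    (\<exists>F :: real set set.
       (\<forall>A\<in>F. ambiguous_in euclidean A) \<and>
       linear_order_on F (inclusion_on F) \<and>
       similar X r F (inclusion_on F))"

definition initial_segment :: "'a set \<Rightarrow> 'a rel \<Rightarrow> 'a set \<Rightarrow> bool"
  where "initial_segment K L H \<longleftrightarrow>
    H \<subseteq> K \<and> (\<forall>a\<in>H. \<forall>b\<in>K. (b, a) \<in> L \<and> b \<noteq> a \<longrightarrow> b \<in> H)"

text \<open>
  Linearity of the inclusion order on \<open>F\<close> is not assumed below, since any two initial segments
  of a linear order are comparable. The order \<open>L\<close> is unrelated to the metric.
\<close>

definition representable_by_ambiguous_segments :: "'a set \<Rightarrow> 'a rel \<Rightarrow> 'k metric \<Rightarrow> bool"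
  where "representable_by_ambiguous_segments X r K \<longleftrightarrow>
    (\<exists>L F. linear_order_on (mspace K) L \<and>
       (\<forall>H\<in>F. initial_segment (mspace K) L H \<and> ambiguous_in (mtopology_of K) H) \<and>
       similar X r F (inclusion_on F))"

text \<open>
  HOL cannot quantify existentially over the type carrying the points of \<open>K\<close>. A compact metric
  space has at most continuum many points, so every one of them is isometric to one whose points
  form a set of reals (with an arbitrary metric, not the usual distance); this is the universe used
  in the equivalence of the theorem. Its second conjunct gives sufficiency for compact metric spaces with points in
  an arbitrary type.
\<close>

end

theory Submission
  imports Defs
begin

text \<open>
  Both directions transport a family along preimages. If \<open>D\<close> is an ambiguous subset of \<open>Y\<close> and
  \<open>f\<close> maps \<open>D\<close> continuously onto \<open>X\<close>, then \<open>A \<mapsto> {y \<in> D. f y \<in> A}\<close> carries ambiguous subsets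
  of \<open>X\<close> to ambiguous subsets of \<open>Y\<close>
  (\<open>ambiguous_in_continuous_preimage\<close>) and is an embedding for inclusion (\<open>similar_preimage\<close>).

  From sets of reals to segments: \<open>tan\<close> maps the open subset \<open>(-\<pi>/2, \<pi>/2)\<close> of the compact
  interval \<open>[-\<pi>/2, \<pi>/2]\<close> onto the line, so a chain of ambiguous sets of reals moves to a similar
  chain of ambiguous subsets of that interval. The members of any chain of sets are initial
  segments of a suitable linear order of the ambient set: put \<open>a\<close> before \<open>b\<close> if every member
  containing \<open>b\<close> contains \<open>a\<close>, and break ties by a given linear order
  (\<open>chain_imp_initial_segments\<close>). Since that order is unrelated to the metric, nothing else is
  needed.

  From segments to sets of reals: initial segments of a linear order form a chain, and a compact
  metric space is a continuous image of a closed set of reals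
  (\<open>compact_metric_continuous_image_of_closed\<close>). To prove the latter, choose countably many pairs
  of closed sets that cover the space and separate its points, and let the ternary digits of a
  real number (restricted to 0 and 1) decide which member of each pair the image point lies in.
\<close>

section \<open>Transport of ambiguous sets along preimages\<close>

lemma fsigma_in_continuous_preimage:
  assumes f: "continuous_map X Y f" and "fsigma_in Y A"
  shows "fsigma_in X {x \<in> topspace X. f x \<in> A}"
proof -
  obtain \<C> where \<C>: "countable \<C>" "\<And>C. C \<in> \<C> \<Longrightarrow> closedin Y C" "\<Union>\<C> = A"
    using assms(2) by (auto simp: fsigma_in_def union_of_def)
  have "{x \<in> topspace X. f x \<in> A} = \<Union>((\<lambda>C. {x \<in> topspace X. f x \<in> C}) ` \<C>)"
    using \<C>(3) by auto
  moreover have "fsigma_in X \<dots>"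
    using \<C> closedin_continuous_map_preimage[OF f]
    by (intro fsigma_in_Union) (auto intro: closed_imp_fsigma_in)
  ultimately show ?thesis
    by simp
qed

lemma gdelta_in_continuous_preimage:
  assumes f: "continuous_map X Y f" and A: "gdelta_in Y A"
  shows "gdelta_in X {x \<in> topspace X. f x \<in> A}"
proof -
  have "topspace X - {x \<in> topspace X. f x \<in> A} = {x \<in> topspace X. f x \<in> topspace Y - A}"
    using continuous_map_funspace[OF f] by auto
  then show ?thesis
    using A fsigma_in_continuous_preimage[OF f, of "topspace Y - A"]
    by (auto simp: gdelta_in_fsigma_in)
qed

lemma ambiguous_in_continuous_preimage:
  assumes D: "ambiguous_in Y D" and f: "continuous_map (subtopology Y D) X f"
    and A: "ambiguous_in X A"
  shows "ambiguous_in Y {y \<in> D. f y \<in> A}"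
proof -
  have "topspace (subtopology Y D) = D"
    using D fsigma_in_subset by (auto simp: ambiguous_in_def)
  then show ?thesis
    using fsigma_in_continuous_preimage[OF f, of A] gdelta_in_continuous_preimage[OF f, of A] D A
    by (simp add: ambiguous_in_def fsigma_in_fsigma_subtopology gdelta_in_gdelta_subtopology)
qed

lemma linear_order_on_inclusion_on:
  assumes "\<And>A B. A \<in> F \<Longrightarrow> B \<in> F \<Longrightarrow> A \<subseteq> B \<or> B \<subseteq> A"
  shows "linear_order_on F (inclusion_on F)"
  unfolding linear_order_on_def inclusion_on_def
proof
  show "partial_order_on F (relation_of (\<subseteq>) F)"
    by (rule partial_order_on_relation_ofI) auto
  show "total_on F (relation_of (\<subseteq>) F)"
    using assms by (auto simp: total_on_def relation_of_def)
qed

lemma chain_if_linear_order_on_inclusion_on: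
  assumes "linear_order_on F (inclusion_on F)" "A \<in> F" "B \<in> F"
  shows "A \<subseteq> B \<or> B \<subseteq> A"
  using assms by (cases "A = B")
    (auto simp: linear_order_on_def total_on_def inclusion_on_def relation_of_def)

lemma similar_preimage:
  assumes "similar X r F (inclusion_on F)" and sub: "\<And>A. A \<in> F \<Longrightarrow> A \<subseteq> f ` D"
  defines "\<Phi> \<equiv> \<lambda>A. {y \<in> D. f y \<in> A}"
  shows "similar X r (\<Phi> ` F) (inclusion_on (\<Phi> ` F))"
proof -
  obtain g where g: "bij_betw g X F"
    and mono: "monotone_on X (\<lambda>a b. (a, b) \<in> r) (\<lambda>a b. (a, b) \<in> inclusion_on F) g"
    using assms(1) by (auto simp: similar_def)
  have "f ` \<Phi> A = A" if "A \<in> F" for A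
    using sub[OF that] by (auto simp: \<Phi>_def)
  then have "bij_betw \<Phi> F (\<Phi> ` F)"
    by (intro bij_betw_imageI inj_on_inverseI[where g = "image f"]) auto
  then have "bij_betw (\<Phi> \<circ> g) X (\<Phi> ` F)"
    using g bij_betw_trans by blast
  moreover have "monotone_on X (\<lambda>a b. (a, b) \<in> r)
      (\<lambda>a b. (a, b) \<in> inclusion_on (\<Phi> ` F)) (\<Phi> \<circ> g)"
    using mono unfolding monotone_on_def inclusion_on_def relation_of_def \<Phi>_def by auto
  ultimately show ?thesis
    by (auto simp: similar_def)
qed

section \<open>Chains of sets as initial segments\<close>

lemma chain_imp_initial_segments:
  fixes S :: "'b :: linorder set"
  assumes chain: "\<And>A B. A \<in> F \<Longrightarrow> B \<in> F \<Longrightarrow> A \<subseteq> B \<or> B \<subseteq> A"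
    and sub: "\<And>A. A \<in> F \<Longrightarrow> A \<subseteq> S"
  shows "\<exists>L. linear_order_on S L \<and> (\<forall>A\<in>F. initial_segment S L A)"
proof (intro exI conjI ballI)
  define before where "before a b \<longleftrightarrow> (\<forall>A\<in>F. b \<in> A \<longrightarrow> a \<in> A)" for a b
  have before_trans: "before a c" if "before a b" "before b c" for a b c
    using that by (auto simp: before_def)
  have before_total: "before a b \<or> before b a" for a b
    using chain unfolding before_def by blast
  let ?P = "\<lambda>a b. before a b \<and> (before b a \<longrightarrow> a \<le> b)"
  show "linear_order_on S (relation_of ?P S)"
    unfolding linear_order_on_def
  proof
    show "partial_order_on S (relation_of ?P S)"
    proof (rule partial_order_on_relation_ofI)
      show "?P a a" for a
        by (simp add: before_def)
      show "?P a c" if "?P a b" "?P b c" for a b c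
        using that before_trans[of a b c] before_trans[of b c a] before_trans[of c a b]
        by auto
      show "a = b" if "?P a b" "?P b a" for a b
        using that by auto
    qed
    show "total_on S (relation_of ?P S)"
      using before_total by (auto simp: total_on_def relation_of_def)
  qed
  show "initial_segment S (relation_of ?P S) A" if "A \<in> F" for A
    using that sub by (auto simp: initial_segment_def relation_of_def before_def)
qed

section \<open>Compact metric spaces as continuous images of closed sets of reals\<close>

text \<open>
  The real numbers \<open>t\<close> such that the fractional part of \<open>3\<^sup>n t\<close> lies in \<open>[0, 1/6]\<close>
  or \<open>[1/3, 1/2]\<close>, according to whether \<open>b\<close> is false or true. If all ternary digits
  of \<open>t\<close> are 0 or 1, this means that the digit at position \<open>n\<close> after the point is \<open>b\<close>
  (counting from 0): the digits beyond it contribute at most \<open>1/6\<close> to \<open>3\<^sup>n t\<close>.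
\<close>

definition ternary_digit :: "nat \<Rightarrow> bool \<Rightarrow> real set" where
  "ternary_digit n b =
     {t. 3 ^ n * t \<in> (\<Union>m\<in>\<int>. \<Union>y\<in>{of_bool b / 3 .. of_bool b / 3 + 1 / 6}. {m + y})}"

lemma closed_ternary_digit: "closed (ternary_digit n b)"
proof -
  have "closed ((\<lambda>t::real. 3 ^ n * t) -`
      (\<Union>m\<in>\<int>. \<Union>y\<in>{of_bool b / 3 .. of_bool b / 3 + 1 / 6}. {m + y}))"
    by (intro closed_vimage closed_compact_sums continuous_intros) auto
  then show ?thesis
    by (simp add: ternary_digit_def vimage_def)
qed

lemma ternary_digit_unique:
  assumes "t \<in> ternary_digit n b" "t \<in> ternary_digit n c"
  shows "b = c"
proof (rule ccontr)
  assume "b \<noteq> c"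
  obtain k l :: int and y z :: real where
    "of_bool b / 3 \<le> y" "y \<le> of_bool b / 3 + 1 / 6" "3 ^ n * t = of_int k + y"
    "of_bool c / 3 \<le> z" "z \<le> of_bool c / 3 + 1 / 6" "3 ^ n * t = of_int l + z"
    using assms by (auto simp: ternary_digit_def elim!: Ints_cases)
  moreover from this have "of_int (k - l) = z - y"
    by simp
  ultimately have "\<bar>real_of_int (k - l)\<bar> < 1" "real_of_int (k - l) \<noteq> 0"
    using \<open>b \<noteq> c\<close> by (cases b; cases c; simp)+
  then show False
    by simp
qed

lemma ternary_digit_independent: "\<exists>t. \<forall>n. t \<in> ternary_digit n (s n)"
proof -
  define T :: "(nat \<Rightarrow> bool) \<Rightarrow> real" where "T s = (\<Sum>k. of_bool (s k) * (1 / 3) ^ Suc k)" for s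
  have geometric: "(\<lambda>k. (1 / 3 :: real) ^ Suc k) sums (1 / 2)"
    using sums_mult[OF geometric_sums[of "1 / 3 :: real"], of "1 / 3"] by simp
  have summable: "summable (\<lambda>k. of_bool (s k) * (1 / 3 :: real) ^ Suc k)" for s :: "nat \<Rightarrow> bool"
    by (rule summable_comparison_test'[OF sums_summable[OF geometric], of 0]) auto
  have T_ge: "0 \<le> T s" for s
    unfolding T_def by (intro suminf_nonneg summable) auto
  have T_le: "T s \<le> 1 / 2" for s
    unfolding T_def sums_unique[OF geometric]
    by (intro suminf_le summable sums_summable[OF geometric]) auto
  have T_rec: "T s = of_bool (s 0) / 3 + T (\<lambda>k. s (Suc k)) / 3" for s
  proof -
    have "(\<Sum>k. of_bool (s (Suc k)) * (1 / 3 :: real) ^ Suc (Suc k))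
        = (\<Sum>k. 1 / 3 * (of_bool (s (Suc k)) * (1 / 3) ^ Suc k))"
      by (simp add: algebra_simps)
    also have "\<dots> = 1 / 3 * T (\<lambda>k. s (Suc k))"
      unfolding T_def by (intro suminf_mult summable)
    finally show ?thesis
      using suminf_split_head[OF summable, of s] by (simp add: T_def)
  qed
  have T_shift: "\<exists>m\<in>\<int>. 3 ^ n * T s = m + T (\<lambda>k. s (k + n))" for n s
  proof (induction n)
    case (Suc n)
    then obtain m where "m \<in> \<int>" and m: "3 ^ n * T s = m + T (\<lambda>k. s (k + n))"
      by blast
    have "3 ^ Suc n * T s = 3 * m + of_bool (s n) + T (\<lambda>k. s (k + Suc n))"
      using m T_rec[of "\<lambda>k. s (k + n)"] by simp
    moreover have "3 * m + of_bool (s n) \<in> \<int>"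
      using \<open>m \<in> \<int>\<close> by simp
    ultimately show ?case
      by blast
  qed simp
  have "T s \<in> ternary_digit n (s n)" for n
  proof -
    obtain m where m: "m \<in> \<int>" "3 ^ n * T s = m + T (\<lambda>k. s (k + n))"
      using T_shift by blast
    have "T (\<lambda>k. s (k + n)) \<in> {of_bool (s n) / 3 .. of_bool (s n) / 3 + 1 / 6}"
      using T_rec[of "\<lambda>k. s (k + n)"] T_ge[of "\<lambda>k. s (Suc k + n)"] T_le[of "\<lambda>k. s (Suc k + n)"]
      by simp
    with m show ?thesis
      unfolding ternary_digit_def by blast
  qed
  then show ?thesis
    by blast
qed

text \<open>
  The graph \<open>G\<close> consists of the pairs \<open>(t, x)\<close> such that each digit of \<open>t\<close> names a member of the
  corresponding pair that contains \<open>x\<close>. It is closed, and since \<open>X\<close> is compact, the projection of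
  a closed subset of \<open>G\<close> to the line is closed; this gives both closedness of the domain and
  continuity. Separation makes \<open>G\<close> single-valued, and independence of the digits makes it reach
  every point of \<open>X\<close>.
\<close>

lemma compact_continuous_image_of_closed:
  fixes A :: "nat \<Rightarrow> bool \<Rightarrow> 'b set"
  assumes compact: "compact_space X" and closed: "\<And>n b. closedin X (A n b)"
    and cover: "\<And>n x. x \<in> topspace X \<Longrightarrow> \<exists>b. x \<in> A n b"
    and separate: "\<And>x y. x \<in> topspace X \<Longrightarrow> y \<in> topspace X \<Longrightarrow> x \<noteq> y \<Longrightarrow>
      \<exists>n. \<forall>b. \<not> (x \<in> A n b \<and> y \<in> A n b)"
  shows "\<exists>(D :: real set) f. closed D \<and> continuous_map (subtopology euclidean D) X f \<and>
    f ` D = topspace X"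
proof -
  define G where "G = (\<Inter>n. \<Union>b. ternary_digit n b \<times> A n b)"
  have G_closed: "closedin (prod_topology euclidean X) G"
    unfolding G_def
  proof (rule closedin_INT)
    show "closedin (prod_topology euclidean X) (\<Union>b. ternary_digit n b \<times> A n b)" for n
      unfolding UNIV_bool
      by (simp add: closedin_Un closedin_prod_Times_iff closed closed_ternary_digit)
  qed simp
  have G_topspace: "x \<in> topspace X" if "(t, x) \<in> G" for t x
    using closedin_subset[OF G_closed] that by auto
  have G_unique: "x = y" if G: "(t, x) \<in> G" "(t, y) \<in> G" for t x y
  proof (rule ccontr)
    assume "x \<noteq> y"
    then obtain n where n: "\<And>b. \<not> (x \<in> A n b \<and> y \<in> A n b)"
      using separate[OF G[THEN G_topspace]] by blast
    obtain b c where "t \<in> ternary_digit n b" "x \<in> A n b" "t \<in> ternary_digit n c" "y \<in> A n c"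
      using G unfolding G_def by blast
    then show False
      using n ternary_digit_unique by blast
  qed
  have G_onto: "\<exists>t. (t, x) \<in> G" if x: "x \<in> topspace X" for x
  proof -
    obtain s where "\<And>n. x \<in> A n (s n)"
      using cover[OF x] by metis
    moreover obtain t where "\<And>n. t \<in> ternary_digit n (s n)"
      using ternary_digit_independent by blast
    ultimately show ?thesis
      unfolding G_def by blast
  qed
  have projection: "closed {t. \<exists>x\<in>C. (t, x) \<in> G}" if C: "closedin X C" for C
  proof -
    have "closedin (prod_topology euclidean X) (G \<inter> (UNIV \<times> C))"
      using G_closed C by (intro closedin_Int) (auto simp: closedin_prod_Times_iff)
    then have "closedin euclidean (fst ` (G \<inter> (UNIV \<times> C)))"
      using closed_map_fst[OF compact] unfolding closed_map_def by blast
    moreover have "fst ` (G \<inter> (UNIV \<times> C)) = {t. \<exists>x\<in>C. (t, x) \<in> G}"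
      by force
    ultimately show ?thesis
      by simp
  qed
  define D where "D = {t. \<exists>x\<in>topspace X. (t, x) \<in> G}"
  define f where "f t = (THE x. (t, x) \<in> G)" for t
  have f: "f t = x" if "(t, x) \<in> G" for t x
    unfolding f_def using that G_unique by blast
  have "closed D"
    unfolding D_def by (rule projection) simp
  moreover have "continuous_map (subtopology euclidean D) X f"
    unfolding continuous_map_closedin
  proof (intro conjI allI impI)
    show "f \<in> topspace (subtopology euclidean D) \<rightarrow> topspace X"
      by (auto simp: D_def f)
    fix C assume C: "closedin X C"
    have "{t \<in> topspace (subtopology euclidean D). f t \<in> C} = {t. \<exists>x\<in>C. (t, x) \<in> G}"
      using closedin_subset[OF C] f by (auto simp: D_def)
    with projection[OF C] show
      "closedin (subtopology euclidean D) {t \<in> topspace (subtopology euclidean D). f t \<in> C}"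
      by (metis (no_types, lifting) closed_subset mem_Collect_eq subsetI topspace_euclidean_subtopology)
  qed
  moreover have "f ` D = topspace X"
    using G_onto by (force simp: D_def f)
  ultimately show ?thesis
    by blast
qed

lemma compact_metric_countable_dense:
  assumes "compact_space (mtopology_of K)"
  shows "\<exists>Q. countable Q \<and> Q \<subseteq> mspace K \<and>
    (\<forall>x\<in>mspace K. \<forall>e>0. \<exists>q\<in>Q. mdist K q x < e)"
proof -
  interpret Metric_space "mspace K" "mdist K"
    by (rule Metric_space_mspace_mdist)
  have "mtotally_bounded (mspace K)"
    using assms compactin_imp_mtotally_bounded by (simp add: compact_space_def mtopology_of_def)
  then have "\<forall>n. \<exists>S. finite S \<and> S \<subseteq> mspace K \<and> mspace K \<subseteq> (\<Union>q\<in>S. mball q (inverse (Suc n)))"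
    unfolding mtotally_bounded_def by simp
  then obtain S where S: "\<And>n. finite (S n)" "\<And>n. S n \<subseteq> mspace K"
      "\<And>n. mspace K \<subseteq> (\<Union>q\<in>S n. mball q (inverse (Suc n)))"
    by metis
  show ?thesis
  proof (intro exI[of _ "\<Union>n. S n"] conjI ballI allI impI)
    show "countable (\<Union>n. S n)"
      using S(1) by (simp add: countable_finite)
    show "(\<Union>n. S n) \<subseteq> mspace K"
      using S(2) by blast
    fix x and e :: real assume x: "x \<in> mspace K" and "0 < e"
    then obtain n where n: "inverse (Suc n) < e"
      using reals_Archimedean by blast
    from x S(3)[of n] obtain p where "p \<in> S n" "mdist K p x < inverse (Suc n)"
      by auto
    with n show "\<exists>q\<in>\<Union>n. S n. mdist K q x < e"
      by (auto intro: less_trans)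
  qed
qed

lemma compact_metric_continuous_image_of_closed:
  assumes compact: "compact_space (mtopology_of K)"
  shows "\<exists>(D :: real set) f. closed D \<and>
    continuous_map (subtopology euclidean D) (mtopology_of K) f \<and> f ` D = mspace K"
proof (cases "mspace K = {}")
  case True
  then show ?thesis
    by (intro exI[of _ "{}"]) (simp add: continuous_map_def)
next
  case False
  obtain Q where Q: "countable Q" "Q \<subseteq> mspace K"
    and dense: "\<And>x e. x \<in> mspace K \<Longrightarrow> 0 < e \<Longrightarrow> \<exists>q\<in>Q. mdist K q x < e"
    using compact_metric_countable_dense[OF compact] by auto
  define I where "I = Q \<times> (\<rat> :: real set)"
  have "Q \<noteq> {}"
    using False dense[of _ 1] by fastforce
  then have I: "countable I" "I \<noteq> {}"
    using Q(1) Rats_0 by (auto simp: I_def countable_rat)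
  define q where "q n = fst (from_nat_into I n)" for n
  define c where "c n = snd (from_nat_into I n)" for n
  have q: "q n \<in> mspace K" for n
    using from_nat_into[OF I(2), of n] Q(2) by (auto simp: q_def I_def)
  \<comment> \<open>The two closed sets cut out by a sphere: the closed ball and the closed exterior.\<close>
  define A where "A n b = {x \<in> mspace K. mdist K (q n) x \<in> (if b then {c n..} else {..c n})}" for n b
  have "\<exists>(D :: real set) f. closed D \<and>
    continuous_map (subtopology euclidean D) (mtopology_of K) f \<and> f ` D = topspace (mtopology_of K)"
  proof (rule compact_continuous_image_of_closed[OF compact])
    show "closedin (mtopology_of K) (A n b)" for n b
      unfolding A_def
      using closedin_continuous_map_preimage[OF continuous_on_mdist[OF q[of n]],
          of "if b then {c n..} else {..c n}"]
      by auto
    show "\<exists>b. x \<in> A n b" if "x \<in> topspace (mtopology_of K)" for n x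
    proof (rule exI)
      show "x \<in> A n (c n \<le> mdist K (q n) x)"
        using that by (auto simp: A_def)
    qed
    fix x y assume "x \<in> topspace (mtopology_of K)" "y \<in> topspace (mtopology_of K)" "x \<noteq> y"
    then have xy: "x \<in> mspace K" "y \<in> mspace K" "0 < mdist K x y"
      using mdist_nonneg[of K x y] by (auto simp: order_less_le)
    obtain p where p: "p \<in> Q" "mdist K p x < mdist K x y / 2"
      using dense[of x "mdist K x y / 2"] xy by auto
    then have "mdist K p x < mdist K p y"
      using mdist_triangle[of x K p y] xy Q(2) by (auto simp: mdist_commute)
    then obtain e where e: "e \<in> \<rat>" "mdist K p x < e" "e < mdist K p y"
      using Rats_dense_in_real by blast
    obtain n where "from_nat_into I n = (p, e)"
      using from_nat_into_surj[OF I(1), of "(p, e)"] p e by (auto simp: I_def)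
    then have "\<not> (x \<in> A n b \<and> y \<in> A n b)" for b
      using e by (auto simp: A_def q_def c_def)
    then show "\<exists>n. \<forall>b. \<not> (x \<in> A n b \<and> y \<in> A n b)"
      by blast
  qed
  then show ?thesis
    by simp
qed

section \<open>Representability\<close>

lemma initial_segment_chain:
  assumes L: "linear_order_on S L" and "initial_segment S L A" "initial_segment S L B"
  shows "A \<subseteq> B \<or> B \<subseteq> A"
proof (rule ccontr)
  assume "\<not> (A \<subseteq> B \<or> B \<subseteq> A)"
  then obtain a b where ab: "a \<in> A" "a \<notin> B" "b \<in> B" "b \<notin> A"
    by blast
  then have "a \<in> S" "b \<in> S" "a \<noteq> b"
    using assms by (auto simp: initial_segment_def)
  then have "(a, b) \<in> L \<or> (b, a) \<in> L"
    using L by (auto simp: linear_order_on_def total_on_def)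
  then show False
    using assms(2,3) ab \<open>a \<in> S\<close> \<open>b \<in> S\<close> unfolding initial_segment_def by metis
qed

lemma representable_by_ambiguous_sets_if_segments:
  assumes compact: "compact_space (mtopology_of K)"
    and "representable_by_ambiguous_segments X r K"
  shows "representable_by_ambiguous_sets X r"
proof -
  obtain L F where L: "linear_order_on (mspace K) L"
    and seg: "\<And>H. H \<in> F \<Longrightarrow> initial_segment (mspace K) L H"
    and amb: "\<And>H. H \<in> F \<Longrightarrow> ambiguous_in (mtopology_of K) H"
    and sim: "similar X r F (inclusion_on F)"
    using assms(2) unfolding representable_by_ambiguous_segments_def by blast
  obtain D :: "real set" and f where D: "closed D" "f ` D = mspace K"
    and f: "continuous_map (subtopology euclidean D) (mtopology_of K) f"
    using compact_metric_continuous_image_of_closed[OF compact] by blast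
  have "ambiguous_in euclidean D"
    using D(1) by (simp add: ambiguous_in_def closed_imp_fsigma_in closed_imp_gdelta_in
        metrizable_space_euclidean)
  note preimage = ambiguous_in_continuous_preimage[OF this f amb]
  let ?\<Phi> = "\<lambda>H. {t \<in> D. f t \<in> H}"
  have "similar X r (?\<Phi> ` F) (inclusion_on (?\<Phi> ` F))"
    using seg D(2) by (intro similar_preimage[OF sim]) (simp add: initial_segment_def)
  moreover have "linear_order_on (?\<Phi> ` F) (inclusion_on (?\<Phi> ` F))"
    using initial_segment_chain[OF L seg seg] by (intro linear_order_on_inclusion_on) blast
  ultimately show ?thesis
    using preimage unfolding representable_by_ambiguous_sets_def
    by (intro exI[of _ "?\<Phi> ` F"]) auto
qed

lemma representable_by_ambiguous_segments_if_sets: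
  assumes "representable_by_ambiguous_sets X r"
  shows "\<exists>K :: real metric. compact_space (mtopology_of K) \<and>
    representable_by_ambiguous_segments X r K"
proof -
  obtain F :: "real set set" where amb: "\<And>A. A \<in> F \<Longrightarrow> ambiguous_in euclidean A"
    and lin: "linear_order_on F (inclusion_on F)" and sim: "similar X r F (inclusion_on F)"
    using assms unfolding representable_by_ambiguous_sets_def by blast
  define K :: "real metric" where "K = submetric euclidean_metric {- (pi / 2)..pi / 2}"
  have K_space: "mspace K = {- (pi / 2)..pi / 2}"
    by (simp add: K_def)
  have K_top: "mtopology_of K = subtopology euclidean {- (pi / 2)..pi / 2}"
    by (simp add: K_def mtopology_of_submetric)
  have compact: "compact_space (mtopology_of K)"
    by (simp add: K_top compact_space_subtopology)
  define D where "D = {- (pi / 2)<..<pi / 2}"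
  have "D \<subseteq> {- (pi / 2)..pi / 2}"
    by (auto simp: D_def)
  then have "openin (mtopology_of K) D"
    unfolding K_top by (intro open_subset) (auto simp: D_def)
  then have "ambiguous_in (mtopology_of K) D"
    by (simp add: ambiguous_in_def open_imp_gdelta_in open_imp_fsigma_in K_top
        metrizable_space_subtopology metrizable_space_euclidean)
  moreover have "continuous_map (subtopology (mtopology_of K) D) euclidean tan"
  proof -
    have "continuous_on D tan"
      unfolding D_def by (intro continuous_intros) (auto dest: cos_gt_zero_pi)
    then show ?thesis
      using \<open>D \<subseteq> _\<close> by (simp add: K_top subtopology_subtopology inf.absorb2)
  qed
  ultimately have preimage: "ambiguous_in (mtopology_of K) {t \<in> D. tan t \<in> A}" if "A \<in> F" for A
    using ambiguous_in_continuous_preimage amb[OF that] by blast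
  let ?\<Phi> = "\<lambda>A. {t \<in> D. tan t \<in> A}"
  have "x \<in> tan ` D" for x
    using tan_arctan[of x] arctan_bounded[of x] by (intro image_eqI[of _ _ "arctan x"]) (auto simp: D_def)
  then have "similar X r (?\<Phi> ` F) (inclusion_on (?\<Phi> ` F))"
    by (intro similar_preimage[OF sim]) blast
  moreover obtain L where "linear_order_on (mspace K) L"
      and "\<forall>H\<in>?\<Phi> ` F. initial_segment (mspace K) L H"
  proof (atomize_elim, rule chain_imp_initial_segments)
    show "A \<subseteq> B \<or> B \<subseteq> A" if "A \<in> ?\<Phi> ` F" "B \<in> ?\<Phi> ` F" for A B
      using that chain_if_linear_order_on_inclusion_on[OF lin] by blast
    show "A \<subseteq> mspace K" if "A \<in> ?\<Phi> ` F" for A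
      using that \<open>D \<subseteq> _\<close> by (auto simp: K_space)
  qed
  ultimately have "representable_by_ambiguous_segments X r K"
    using preimage unfolding representable_by_ambiguous_segments_def
    by (intro exI[of _ L] exI[of _ "?\<Phi> ` F"]) auto
  with compact show ?thesis
    by blast
qed

theorem theorem5p1:
  fixes X :: "'a set" and r :: "'a rel"
  assumes "linear_order_on X r"
  shows "(representable_by_ambiguous_sets X r \<longleftrightarrow>
           (\<exists>K :: real metric. compact_space (mtopology_of K) \<and>
              representable_by_ambiguous_segments X r K)) \<and>
         ((\<exists>K :: 'k metric. compact_space (mtopology_of K) \<and>
              representable_by_ambiguous_segments X r K) \<longrightarrow>
           representable_by_ambiguous_sets X r)"
proof (intro conjI iffI impI)
  assume "representable_by_ambiguous_sets X r"
  then show "\<exists>K :: real metric. compact_space (mtopology_of K) \<and>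
      representable_by_ambiguous_segments X r K"
    by (rule representable_by_ambiguous_segments_if_sets)
qed (blast intro: representable_by_ambiguous_sets_if_segments)+

end
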